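(* Let $A,B\in\mathrm{M}_n(K)$ be $n\times n$ matrices over a field $K$. Then the following are equivalent: 1. $\mathrm{Cen}_0(A)\subseteq\mathrm{Cen}_0(B)$; 2. $\ker(A)\subseteq\ker(B)$ and $\ker(A^{\top})\subseteq\ker(B^{\top})$; 3. $\mathrm{im}(B)\subseteq\mathrm{im}(A)$ and $\mathrm{im}(B^{\top})\subseteq\mathrm{im}(A^{\top})$.
   Context: $\mathrm{Cen}_0(A)=\{C\in\mathrm{M}_n(K)\mid CA=AC=0\}$. $A^{\top}$ is the transpose of $A$. Matrices act on column vectors in $K^n$, and $\ker$ and $\mathrm{im}$ refer to the corresponding linear maps $K^n\to K^n$. *)

theory Defs
  imports "HOL-Analysis.Analysis"
begin

definition cen0 :: "'k::field ^ 'n ^ 'n \<Rightarrow> ('k ^ 'n ^ 'n) set" where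
  "cen0 A = {C. C ** A = 0 \<and> A ** C = 0}"

definition ker_mat :: "'k::field ^ 'n ^ 'n \<Rightarrow> ('k ^ 'n) set" where
  "ker_mat A = {x. A *v x = 0}"

definition im_mat :: "'k::field ^ 'n ^ 'n \<Rightarrow> ('k ^ 'n) set" where
  "im_mat A = range (\<lambda>x. A *v x)"

end

theory Submission
  imports Defs
begin

text \<open>
  The kernel conditions mediate between the other two. A relation \<open>A ** C = 0\<close> says that the columns
  of \<open>C\<close> lie in the kernel of \<open>A\<close>, and \<open>C ** A = 0\<close> says that its rows lie in the kernel of
  \<open>transpose A\<close>; so inclusions of the two kernels give an inclusion of the annihilators. For the
  converse the annihilator is tested on matrices of rank one, \<open>outer x y\<close> with \<open>x\<close> in the kernel
  of \<open>A\<close> and \<open>y\<close> in the kernel of \<open>transpose A\<close>. To detect \<open>B *v x = 0\<close> in this way, some nonzero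
  \<open>y\<close> must be available; it is, because for a square matrix \<open>A\<close> and \<open>transpose A\<close> are singular
  together (lemma \<open>ker_transpose_trivial\<close>), so a nonzero \<open>x\<close> guarantees a nonzero \<open>y\<close>.

  Kernels and images are exchanged by transposition: \<open>ker A \<subseteq> ker B\<close> and
  \<open>im (transpose B) \<subseteq> im (transpose A)\<close> both say that \<open>B = X ** A\<close> for some \<open>X\<close>. For the kernels
  such an \<open>X\<close> comes from a generalized inverse \<open>G\<close> of \<open>A\<close>, that is, \<open>A ** G ** A = A\<close>: then
  \<open>x - (G ** A) *v x\<close> always lies in the kernel of \<open>A\<close>, hence in that of \<open>B\<close>, and \<open>X = B ** G\<close> works.
\<close>

definition outer :: "'k::semiring_1 ^ 'm \<Rightarrow> 'k ^ 'n \<Rightarrow> 'k ^ 'n ^ 'm" where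
  "outer x y = (\<chi> i j. x $ i * y $ j)"

lemma matrix_mult_outer: "M ** outer x y = outer (M *v x) y"
  by (simp add: outer_def matrix_matrix_mult_def matrix_vector_mult_def vec_eq_iff
      sum_distrib_right mult.assoc)

lemma outer_matrix_mult:
  fixes M :: "'k::comm_semiring_1 ^ 'n ^ 'm"
  shows "outer x y ** M = outer x (transpose M *v y)"
  by (simp add: outer_def matrix_matrix_mult_def matrix_vector_mult_def transpose_def vec_eq_iff
      sum_distrib_left ac_simps)

lemma outer_eq_0_iff:
  fixes x :: "'k::semiring_1_no_zero_divisors ^ 'm"
  shows "outer x y = 0 \<longleftrightarrow> x = 0 \<or> y = 0"
  by (auto simp: outer_def vec_eq_iff)

lemma transpose_eq_0_iff: "transpose M = 0 \<longleftrightarrow> M = 0"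
  by (auto simp: transpose_def vec_eq_iff)

text \<open>A left inverse of a square matrix is also a right inverse, and transposing a right inverse
  of \<open>transpose A\<close> gives a left inverse of \<open>A\<close>.\<close>

lemma ker_transpose_trivial:
  fixes A :: "'k::field ^ 'n ^ 'n"
  assumes "ker_mat (transpose A) \<subseteq> {0}"
  shows "ker_mat A \<subseteq> {0}"
proof -
  obtain L where "L ** transpose A = mat 1"
    using assms matrix_left_invertible_ker[of "transpose A"] by (auto simp: ker_mat_def)
  then have "transpose A ** L = mat 1"
    by (simp only: matrix_left_right_inverse)
  then have "transpose (transpose A ** L) = mat 1"
    by (simp add: transpose_mat)
  then have "transpose L ** A = mat 1"
    by (simp add: matrix_transpose_mul)
  then show ?thesis
    using matrix_left_invertible_ker[of A] by (auto simp: ker_mat_def)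
qed

lemma ker_subset_imp_mult_eq_0:
  fixes A B C :: "'k::field ^ 'n ^ 'n"
  assumes "ker_mat A \<subseteq> ker_mat B" "A ** C = 0"
  shows "B ** C = 0"
proof -
  have "A *v (C *v v) = 0" for v
    using assms(2) by (simp add: matrix_vector_mul_assoc)
  then have "B *v (C *v v) = 0" for v
    using assms(1) by (auto simp: ker_mat_def)
  then show ?thesis
    by (simp add: matrix_eq matrix_vector_mul_assoc)
qed

lemma mem_cen0_transpose_iff:
  "transpose C \<in> cen0 (transpose A) \<longleftrightarrow> C \<in> cen0 A"
  by (auto simp: cen0_def transpose_eq_0_iff simp flip: matrix_transpose_mul)

lemma cen0_transpose_mono:
  assumes "cen0 A \<subseteq> cen0 B"
  shows "cen0 (transpose A) \<subseteq> cen0 (transpose B)"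
proof
  fix C assume "C \<in> cen0 (transpose A)"
  then have "transpose C \<in> cen0 A"
    using mem_cen0_transpose_iff[of "transpose C" A] by simp
  then have "transpose C \<in> cen0 B"
    using assms by blast
  then show "C \<in> cen0 (transpose B)"
    using mem_cen0_transpose_iff[of "transpose C" B] by simp
qed

lemma ker_subset_if_cen0_subset:
  fixes A B :: "'k::field ^ 'n ^ 'n"
  assumes "cen0 A \<subseteq> cen0 B"
  shows "ker_mat A \<subseteq> ker_mat B"
proof
  fix x assume x: "x \<in> ker_mat A"
  show "x \<in> ker_mat B"
  proof (cases "x = 0")
    case True
    then show ?thesis by (simp add: ker_mat_def)
  next
    case False
    then obtain y where y: "y \<in> ker_mat (transpose A)" "y \<noteq> 0"
      using x ker_transpose_trivial[of A] by blast
    have "outer x y \<in> cen0 A"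
      using x y by (simp add: cen0_def ker_mat_def matrix_mult_outer outer_matrix_mult outer_eq_0_iff)
    then have "outer (B *v x) y = 0"
      using assms by (auto simp: cen0_def simp flip: matrix_mult_outer)
    with y show ?thesis by (simp add: ker_mat_def outer_eq_0_iff)
  qed
qed

lemma cen0_subset_iff_ker_subset:
  fixes A B :: "'k::field ^ 'n ^ 'n"
  shows "cen0 A \<subseteq> cen0 B \<longleftrightarrow>
    ker_mat A \<subseteq> ker_mat B \<and> ker_mat (transpose A) \<subseteq> ker_mat (transpose B)"
proof
  assume "cen0 A \<subseteq> cen0 B"
  then show "ker_mat A \<subseteq> ker_mat B \<and> ker_mat (transpose A) \<subseteq> ker_mat (transpose B)"
    using ker_subset_if_cen0_subset cen0_transpose_mono by blast
next
  assume ker: "ker_mat A \<subseteq> ker_mat B \<and> ker_mat (transpose A) \<subseteq> ker_mat (transpose B)"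
  show "cen0 A \<subseteq> cen0 B"
  proof
    fix C assume "C \<in> cen0 A"
    then have "A ** C = 0" "transpose A ** transpose C = 0"
      by (simp_all add: cen0_def transpose_eq_0_iff flip: matrix_transpose_mul)
    then have "B ** C = 0" "transpose B ** transpose C = 0"
      using ker ker_subset_imp_mult_eq_0 by blast+
    then show "C \<in> cen0 B"
      by (simp add: cen0_def transpose_eq_0_iff flip: matrix_transpose_mul)
  qed
qed

text \<open>A linear right inverse of \<open>A\<close> on its image, defined on the whole space, serves as \<open>G\<close>.\<close>

lemma generalized_inverse_exists:
  fixes A :: "'k::field ^ 'n ^ 'm"
  obtains G where "A ** G ** A = A"
proof -
  obtain g where g: "Vector_Spaces.linear (*s) (*s) g" "\<forall>y\<in>range ((*v) A). A *v g y = y"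
    using vec.linear_exists_right_inverse_on[OF matrix_vector_mul_linear_gen[of A] vec.subspace_UNIV]
    by blast
  have "A ** matrix g ** A = A"
    using g by (simp add: matrix_eq matrix_works flip: matrix_vector_mul_assoc)
  then show thesis by (rule that)
qed

lemma ker_subset_iff_left_multiple:
  fixes A B :: "'k::field ^ 'n ^ 'n"
  shows "ker_mat A \<subseteq> ker_mat B \<longleftrightarrow> (\<exists>X. B = X ** A)"
proof
  assume ker: "ker_mat A \<subseteq> ker_mat B"
  obtain G where G: "A ** G ** A = A"
    by (rule generalized_inverse_exists)
  have "B *v x = (B ** G ** A) *v x" for x
  proof -
    have "x - (G ** A) *v x \<in> ker_mat A"
      using G by (simp add: ker_mat_def matrix_vector_mult_diff_distrib matrix_vector_mul_assoc
          matrix_mul_assoc)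
    then have "B *v (x - (G ** A) *v x) = 0"
      using ker unfolding ker_mat_def by blast
    then show ?thesis
      by (simp add: matrix_vector_mult_diff_distrib matrix_vector_mul_assoc matrix_mul_assoc)
  qed
  then show "\<exists>X. B = X ** A"
    by (auto simp: matrix_eq)
next
  assume "\<exists>X. B = X ** A"
  then show "ker_mat A \<subseteq> ker_mat B"
    by (auto simp: ker_mat_def simp flip: matrix_vector_mul_assoc)
qed

text \<open>The columns of \<open>B\<close> are images under \<open>A\<close>, and their preimages are the columns of \<open>X\<close>.\<close>

lemma im_subset_iff_right_multiple:
  fixes A B :: "'k::field ^ 'n ^ 'n"
  shows "im_mat B \<subseteq> im_mat A \<longleftrightarrow> (\<exists>X. B = A ** X)"
proof
  assume "im_mat B \<subseteq> im_mat A"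
  then have "\<forall>j. \<exists>v. B *v axis j 1 = A *v v"
    by (auto simp: im_mat_def)
  then obtain v where v: "\<And>j. B *v axis j 1 = A *v v j"
    by metis
  have "B = A ** (\<chi> i j. v j $ i)"
  proof -
    have "B $ i $ j = (B *v axis j 1) $ i" for i j
      by (simp add: matrix_vector_mult_def axis_def if_distrib cong: if_cong)
    then show ?thesis
      unfolding v by (simp add: vec_eq_iff matrix_matrix_mult_def matrix_vector_mult_def)
  qed
  then show "\<exists>X. B = A ** X" ..
next
  assume "\<exists>X. B = A ** X"
  then show "im_mat B \<subseteq> im_mat A"
    by (auto simp: im_mat_def simp flip: matrix_vector_mul_assoc)
qed

lemma ker_subset_iff_im_transpose_subset:
  fixes A B :: "'k::field ^ 'n ^ 'n"
  shows "ker_mat A \<subseteq> ker_mat B \<longleftrightarrow> im_mat (transpose B) \<subseteq> im_mat (transpose A)"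
proof -
  have "(\<exists>X. B = X ** A) \<longleftrightarrow> (\<exists>X. transpose B = transpose A ** X)"
  proof
    assume "\<exists>X. B = X ** A"
    then show "\<exists>X. transpose B = transpose A ** X"
      by (auto simp: matrix_transpose_mul)
  next
    assume "\<exists>X. transpose B = transpose A ** X"
    then obtain X where "transpose B = transpose A ** X" ..
    then have "transpose (transpose B) = transpose (transpose A ** X)"
      by (rule arg_cong)
    then have "B = transpose X ** A"
      by (simp add: matrix_transpose_mul)
    then show "\<exists>X. B = X ** A" ..
  qed
  then show ?thesis
    by (simp only: ker_subset_iff_left_multiple im_subset_iff_right_multiple)
qed

theorem theorem4p5:
  fixes A B :: "'k::field ^ 'n ^ 'n"
  shows
    "(cen0 A \<subseteq> cen0 B
        \<longleftrightarrow> ker_mat A \<subseteq> ker_mat B \<and> ker_mat (transpose A) \<subseteq> ker_mat (transpose B)) \<and>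
     (ker_mat A \<subseteq> ker_mat B \<and> ker_mat (transpose A) \<subseteq> ker_mat (transpose B)
        \<longleftrightarrow> im_mat B \<subseteq> im_mat A \<and> im_mat (transpose B) \<subseteq> im_mat (transpose A))"
  using cen0_subset_iff_ker_subset[of A B] ker_subset_iff_im_transpose_subset[of A B]
    ker_subset_iff_im_transpose_subset[of "transpose A" "transpose B"]
  by auto

end
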